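(* Let $n_1,\ldots,n_\ell$ be positive integers and denote $n:=\sum_{i=1}^\ell n_i$. Then the product $S:=\prod_{i=1}^\ell\overline{B}_{n_i}\subset\mathbb{R}^n$ has dimension $n$ and it is an $n$-brick.
   Context: $\overline{B}_m$ denotes the closed unit ball of $\mathbb{R}^m$ centered at the origin. An $n$-dimensional semialgebraic set $T\subset\mathbb{R}^n$ is an $m$-brick if there exists a homotopy $H=(H_1,\ldots,H_n):[0,1]\times\overline{B}_m\to T$ such that: (1) each $H_i$ is the restriction to $[0,1]\times\overline{B}_m$ of a polynomial of the ring $\mathcal{C}^0([0,1])[x_1,\ldots,x_m]$, where $\mathcal{C}^0([0,1])$ is the ring of continuous real functions on $[0,1]$; (2) $H(\{0\}\times\overline{B}_m)=T$ and $H(1,\cdot)$ is a constant map; (3) $H(\{t\}\times\overline{B}_m)\subset\operatorname{Int}(T)$ for each $t\in(0,1)$, where $\operatorname{Int}$ is the topological interior in $\mathbb{R}^n$. *)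

theory Defs
  imports "HOL-Analysis.Analysis" "HOL-Algebra.Ideal"
begin

text \<open>
  The space of dimension \<open>n\<close> is rendered by the library topology \<^const>\<open>Euclidean_space\<close>:
  its points are the sequences \<open>x :: nat \<Rightarrow> real\<close> with \<open>x i = 0\<close> for \<open>i \<ge> n\<close>, so the
  coordinates are \<open>x 0, \<dots>, x (n - 1)\<close>.
\<close>

abbreviation Rn :: "nat \<Rightarrow> (nat \<Rightarrow> real) set"
  where "Rn n \<equiv> topspace (Euclidean_space n)"

definition closed_unit_ball :: "nat \<Rightarrow> (nat \<Rightarrow> real) set"
  where "closed_unit_ball m = {x \<in> Rn m. L2_set x {..<m} \<le> 1}"

text \<open>
  The value at \<open>x\<close> of the polynomial in \<open>m\<close> variables with coefficient \<open>c \<alpha>\<close> at the monomial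
  of multi-exponent \<open>\<alpha>\<close>, where \<open>\<alpha>\<close> ranges over the finite set \<open>A\<close>.
\<close>

definition poly_value ::
    "nat \<Rightarrow> (nat \<Rightarrow> nat) set \<Rightarrow> ((nat \<Rightarrow> nat) \<Rightarrow> real) \<Rightarrow> (nat \<Rightarrow> real) \<Rightarrow> real"
  where "poly_value m A c x = (\<Sum>\<alpha>\<in>A. c \<alpha> * (\<Prod>j<m. x j ^ \<alpha> j))"

definition polynomial_map :: "nat \<Rightarrow> ((nat \<Rightarrow> real) \<Rightarrow> real) \<Rightarrow> bool"
  where "polynomial_map m f \<longleftrightarrow> (\<exists>A c. finite A \<and> (\<forall>x. f x = poly_value m A c x))"

text \<open>
  \<open>h\<close> is, on \<open>[0,1] \<times> D\<close>, the restriction of a polynomial in \<open>m\<close> variables whose coefficients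
  are continuous real functions on \<open>[0,1]\<close>.
\<close>

definition C0_polynomial_on ::
    "nat \<Rightarrow> (nat \<Rightarrow> real) set \<Rightarrow> (real \<Rightarrow> (nat \<Rightarrow> real) \<Rightarrow> real) \<Rightarrow> bool"
  where "C0_polynomial_on m D h \<longleftrightarrow>
    (\<exists>A c. finite A \<and> (\<forall>\<alpha>\<in>A. continuous_on {0..1} (c \<alpha>)) \<and>
      (\<forall>t\<in>{0..1}. \<forall>x\<in>D. h t x = poly_value m A (\<lambda>\<alpha>. c \<alpha> t) x))"

text \<open>
  The semialgebraic subsets of the space of dimension \<open>n\<close> form the smallest family containing
  the sets \<open>{f > 0}\<close> with \<open>f\<close> polynomial and closed under finite Boolean operations.
\<close>

inductive semialgebraic :: "nat \<Rightarrow> (nat \<Rightarrow> real) set \<Rightarrow> bool" for n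
  where
    positive: "polynomial_map n f \<Longrightarrow> semialgebraic n {x \<in> Rn n. f x > 0}"
  | complement: "semialgebraic n S \<Longrightarrow> semialgebraic n (Rn n - S)"
  | inter: "semialgebraic n S \<Longrightarrow> semialgebraic n T \<Longrightarrow> semialgebraic n (S \<inter> T)"
  | union: "semialgebraic n S \<Longrightarrow> semialgebraic n T \<Longrightarrow> semialgebraic n (S \<union> T)"

text \<open>
  The dimension of a semialgebraic set \<open>S\<close> is the Krull dimension of the ring of polynomial
  functions on \<open>S\<close>, that is, of the quotient of the polynomial ring in \<open>n\<close> variables by the
  ideal of the polynomials vanishing on \<open>S\<close> (Bochnak, Coste and Roy, Real Algebraic Geometry,
  Section 2.8). The functions are restricted to \<open>S\<close> in the sense of \<^const>\<open>restrict\<close>, so that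
  two polynomials agreeing on \<open>S\<close> give the same element.
\<close>

definition polynomial_functions_ring ::
    "nat \<Rightarrow> (nat \<Rightarrow> real) set \<Rightarrow> ((nat \<Rightarrow> real) \<Rightarrow> real) ring"
  where "polynomial_functions_ring n S =
    \<lparr>carrier = {restrict f S |f. polynomial_map n f},
     monoid.mult = (\<lambda>f g. \<lambda>x\<in>S. f x * g x),
     one = (\<lambda>x\<in>S. 1),
     zero = (\<lambda>x\<in>S. 0),
     add = (\<lambda>f g. \<lambda>x\<in>S. f x + g x)\<rparr>"

definition prime_chain :: "('a, 'b) ring_scheme \<Rightarrow> nat \<Rightarrow> (nat \<Rightarrow> 'a set) \<Rightarrow> bool"
  where "prime_chain R k P \<longleftrightarrow>
    (\<forall>i\<le>k. primeideal (P i) R) \<and> (\<forall>i<k. P i \<subset> P (Suc i))"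

text \<open>The Krull dimension of the zero ring is \<open>-\<infinity>\<close>, the supremum of the empty set.\<close>

definition krull_dim :: "('a, 'b) ring_scheme \<Rightarrow> ereal"
  where "krull_dim R = (SUP k \<in> {k. \<exists>P. prime_chain R k P}. ereal (real k))"

definition semialgebraic_dim :: "nat \<Rightarrow> (nat \<Rightarrow> real) set \<Rightarrow> ereal"
  where "semialgebraic_dim n S = krull_dim (polynomial_functions_ring n S)"

definition brick :: "nat \<Rightarrow> nat \<Rightarrow> (nat \<Rightarrow> real) set \<Rightarrow> bool"
  where "brick m n T \<longleftrightarrow>
    T \<subseteq> Rn n \<and> semialgebraic n T \<and> semialgebraic_dim n T = ereal (real n) \<and>
    (\<exists>H :: real \<Rightarrow> (nat \<Rightarrow> real) \<Rightarrow> nat \<Rightarrow> real.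
      continuous_map
        (prod_topology (top_of_set {0..1})
          (subtopology (Euclidean_space m) (closed_unit_ball m)))
        (subtopology (Euclidean_space n) T) (\<lambda>(t, x). H t x) \<and>
      (\<forall>i<n. C0_polynomial_on m (closed_unit_ball m) (\<lambda>t x. H t x i)) \<and>
      H 0 ` closed_unit_ball m = T \<and>
      (\<exists>p. \<forall>x\<in>closed_unit_ball m. H 1 x = p) \<and>
      (\<forall>t\<in>{0<..<1}. H t ` closed_unit_ball m \<subseteq> Euclidean_space n interior_of T))"

text \<open>
  A point of the space of dimension \<open>d 0 + \<dots> + d (l - 1)\<close> is identified with the tuple of its
  consecutive blocks of \<open>d 0, \<dots>, d (l - 1)\<close> coordinates; the factors of a product are
  indexed from \<open>0\<close>.
\<close>

definition block :: "(nat \<Rightarrow> nat) \<Rightarrow> nat \<Rightarrow> (nat \<Rightarrow> real) \<Rightarrow> nat \<Rightarrow> real"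
  where "block d i x = (\<lambda>k. if k < d i then x ((\<Sum>j<i. d j) + k) else 0)"

definition block_product ::
    "nat \<Rightarrow> (nat \<Rightarrow> nat) \<Rightarrow> (nat \<Rightarrow> (nat \<Rightarrow> real) set) \<Rightarrow> (nat \<Rightarrow> real) set"
  where "block_product l d A = {x \<in> Rn (\<Sum>i<l. d i). \<forall>i<l. block d i x \<in> A i}"

end

theory Submission
  imports Defs
begin

text \<open>
  Both parts of the claim hold for any product of unit balls whose factors correspond to the classes
  of a partition of the coordinates, and the partition is given by a labelling \<open>b\<close> of the
  coordinates.

  The homotopy. On the ball, the map \<open>x \<mapsto> (3 - 4 * \<bar>x\<bar>\<^sup>2) * x\<close> is a radial version of the Chebyshev
  polynomial of degree three: it maps the unit ball into itself and the ball of radius \<open>r / 2\<close>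
  onto a set containing the ball of radius \<open>r\<close>, for every \<open>r \<le> 1\<close>. Applying it to all factors
  simultaneously (\<open>fold_map\<close>) and iterating, a polynomial self-map of the product \<open>S\<close> arises that
  sends a small product of balls, contained in the unit ball of the whole space, onto all of
  \<open>S\<close>. As the unit ball of the whole space is contained in \<open>S\<close>, its image is exactly \<open>S\<close>
  (\<open>funpow_fold_map_image_closed_unit_ball\<close>). Multiplying this polynomial map by \<open>1 - t\<close> gives the
  homotopy, since \<open>S\<close> is convex with the origin in its interior (\<open>multiball_brick\<close>).

  The dimension. Since \<open>S\<close> is convex, whether a polynomial vanishes on the intersection of \<open>S\<close> with
  a coordinate subspace can be tested on segments, where it has one variable; hence the vanishing
  ideals of these intersections are prime, and they form a chain of length \<open>n\<close> (\<open>semialgebraic_dim_convex\<close>).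
  Conversely, choose one element from each gap of a chain of primes. Looking at lowest exponents
  shows that these elements satisfy no polynomial relation (\<open>prime_chain_expression_notin\<close>),
  whereas any \<open>n + 1\<close> polynomials in \<open>n\<close> variables do satisfy one, because there are more
  products of their powers than monomials (\<open>polynomial_maps_algebraically_dependent\<close>). Hence the
  dimension is at most \<open>n\<close> (\<open>semialgebraic_dim_le\<close>).
\<close>

section \<open>Polynomial maps of bounded degree\<close>

text \<open>
  Exponents outside \<open>{..<n}\<close> do not affect the value of a monomial; restricting to extensional
  exponents makes the monomials of degree at most \<open>D\<close> in each variable a set of exactly
  \<open>(D + 1) ^ n\<close> elements.
\<close>

definition exponent_box :: "nat \<Rightarrow> nat \<Rightarrow> (nat \<Rightarrow> nat) set"
  where "exponent_box n D = {..<n} \<rightarrow>\<^sub>E {..D}"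

definition polynomial_map_deg :: "nat \<Rightarrow> nat \<Rightarrow> ((nat \<Rightarrow> real) \<Rightarrow> real) \<Rightarrow> bool"
  where "polynomial_map_deg n D f \<longleftrightarrow> (\<exists>c. \<forall>x. f x = poly_value n (exponent_box n D) c x)"

lemma finite_exponent_box: "finite (exponent_box n D)"
  unfolding exponent_box_def by (intro finite_PiE) auto

lemma card_exponent_box: "card (exponent_box n D) = (D + 1) ^ n"
  unfolding exponent_box_def by (simp add: card_PiE)

text \<open>
  Different indices may carry the same monomial here, so no like terms have to be collected when
  a product is multiplied out.
\<close>

lemma polynomial_map_degI:
  assumes "finite K" and le: "\<And>k j. k \<in> K \<Longrightarrow> j < n \<Longrightarrow> e k j \<le> D"
    and f: "\<And>x. f x = (\<Sum>k\<in>K. c k * (\<Prod>j<n. x j ^ e k j))"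
  shows "polynomial_map_deg n D f"
proof -
  let ?g = "\<lambda>k. restrict (e k) {..<n}"
  let ?c = "\<lambda>\<alpha>. \<Sum>k\<in>{k \<in> K. ?g k = \<alpha>}. c k"
  have g: "?g ` K \<subseteq> exponent_box n D"
    using le by (auto simp: exponent_box_def restrict_PiE_iff image_subset_iff)
  have "f x = poly_value n (exponent_box n D) ?c x" for x
  proof -
    have "f x = (\<Sum>k\<in>K. c k * (\<Prod>j<n. x j ^ ?g k j))"
      unfolding f by simp
    also have "\<dots> = (\<Sum>\<alpha>\<in>exponent_box n D. \<Sum>k\<in>{k \<in> K. ?g k = \<alpha>}. c k * (\<Prod>j<n. x j ^ ?g k j))"
      by (rule sum.group[OF \<open>finite K\<close> finite_exponent_box g, symmetric])
    also have "\<dots> = (\<Sum>\<alpha>\<in>exponent_box n D. \<Sum>k\<in>{k \<in> K. ?g k = \<alpha>}. c k * (\<Prod>j<n. x j ^ \<alpha> j))"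
      by (intro sum.cong refl) auto
    also have "\<dots> = poly_value n (exponent_box n D) ?c x"
      by (simp add: poly_value_def sum_distrib_right)
    finally show ?thesis .
  qed
  then show ?thesis
    unfolding polynomial_map_deg_def by blast
qed

lemma polynomial_map_deg_mono:
  assumes "polynomial_map_deg n D f" "D \<le> E"
  shows "polynomial_map_deg n E f"
proof -
  obtain c where c: "\<And>x. f x = (\<Sum>k\<in>exponent_box n D. c k * (\<Prod>j<n. x j ^ k j))"
    using assms(1) by (auto simp: polynomial_map_deg_def poly_value_def)
  have "k j \<le> E" if "k \<in> exponent_box n D" "j < n" for k j
    using that \<open>D \<le> E\<close> by (force simp: exponent_box_def PiE_iff)
  then show ?thesis
    by (rule polynomial_map_degI[where e = "\<lambda>k. k", OF finite_exponent_box _ c])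
qed

lemma polynomial_map_deg_mult:
  assumes "polynomial_map_deg n D f" "polynomial_map_deg n E g"
  shows "polynomial_map_deg n (D + E) (\<lambda>x. f x * g x)"
proof -
  obtain c where c: "\<And>x. f x = (\<Sum>k\<in>exponent_box n D. c k * (\<Prod>j<n. x j ^ k j))"
    using assms(1) by (auto simp: polynomial_map_deg_def poly_value_def)
  obtain c' where c': "\<And>x. g x = (\<Sum>k\<in>exponent_box n E. c' k * (\<Prod>j<n. x j ^ k j))"
    using assms(2) by (auto simp: polynomial_map_deg_def poly_value_def)
  show ?thesis
  proof (rule polynomial_map_degI[where e = "\<lambda>(\<alpha>, \<beta>) j. \<alpha> j + \<beta> j" and c = "\<lambda>(\<alpha>, \<beta>). c \<alpha> * c' \<beta>"])
    show "finite (exponent_box n D \<times> exponent_box n E)"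
      by (simp add: finite_exponent_box)
    show "(case k of (\<alpha>, \<beta>) \<Rightarrow> \<lambda>j. \<alpha> j + \<beta> j) j \<le> D + E"
      if "k \<in> exponent_box n D \<times> exponent_box n E" "j < n" for k j
      using that by (auto simp: exponent_box_def PiE_iff intro!: add_mono)
    show "f x * g x = (\<Sum>k\<in>exponent_box n D \<times> exponent_box n E. (case k of (\<alpha>, \<beta>) \<Rightarrow> c \<alpha> * c' \<beta>) *
        (\<Prod>j<n. x j ^ (case k of (\<alpha>, \<beta>) \<Rightarrow> \<lambda>j. \<alpha> j + \<beta> j) j))" for x
      unfolding c c' sum_product sum.cartesian_product
      by (intro sum.cong refl) (auto simp: power_add prod.distrib)
  qed
qed

lemma polynomial_map_deg_add:
  assumes "polynomial_map_deg n D f" "polynomial_map_deg n D g"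
  shows "polynomial_map_deg n D (\<lambda>x. f x + g x)"
proof -
  obtain c c' where "\<And>x. f x = poly_value n (exponent_box n D) c x"
    "\<And>x. g x = poly_value n (exponent_box n D) c' x"
    using assms unfolding polynomial_map_deg_def by metis
  then have "f x + g x = poly_value n (exponent_box n D) (\<lambda>\<alpha>. c \<alpha> + c' \<alpha>) x" for x
    by (simp add: poly_value_def distrib_right sum.distrib)
  then show ?thesis
    unfolding polynomial_map_deg_def by blast
qed

lemma polynomial_map_deg_const: "polynomial_map_deg n D (\<lambda>x. r)"
  by (rule polynomial_map_degI[of "{()}" _ "\<lambda>_ _. 0" _ _ "\<lambda>_. r"]) auto

lemma polynomial_map_deg_power:
  assumes "polynomial_map_deg n D f"
  shows "polynomial_map_deg n (k * D) (\<lambda>x. f x ^ k)"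
  by (induction k) (auto simp: polynomial_map_deg_const intro: polynomial_map_deg_mult[OF assms])

lemma polynomial_map_deg_prod:
  assumes "\<And>i. i < m \<Longrightarrow> polynomial_map_deg n D (f i)"
  shows "polynomial_map_deg n (m * D) (\<lambda>x. \<Prod>i<m. f i x)"
  using assms
proof (induction m)
  case 0
  show ?case by (simp add: polynomial_map_deg_const)
next
  case (Suc m)
  then have "polynomial_map_deg n (m * D + D) (\<lambda>x. (\<Prod>i<m. f i x) * f m x)"
    by (intro polynomial_map_deg_mult) auto
  then show ?case
    by (simp add: add.commute)
qed

lemma polynomial_map_iff_deg: "polynomial_map n f \<longleftrightarrow> (\<exists>D. polynomial_map_deg n D f)"
proof
  assume "polynomial_map n f"
  then obtain A c where A: "finite A" "\<And>x. f x = poly_value n A c x"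
    by (auto simp: polynomial_map_def)
  have "finite ((\<lambda>(\<alpha>, j). \<alpha> j) ` (A \<times> {..<n}))"
    using A by auto
  then obtain D where "\<forall>k\<in>(\<lambda>(\<alpha>, j). \<alpha> j) ` (A \<times> {..<n}). k \<le> D"
    unfolding finite_nat_set_iff_bounded_le by blast
  then have "polynomial_map_deg n D f"
    using A by (intro polynomial_map_degI[of A n "\<lambda>\<alpha>. \<alpha>" D f c]) (auto simp: poly_value_def)
  then show "\<exists>D. polynomial_map_deg n D f" ..
qed (auto simp: polynomial_map_def polynomial_map_deg_def intro: finite_exponent_box)

lemma polynomial_map_add:
  assumes "polynomial_map n f" "polynomial_map n g"
  shows "polynomial_map n (\<lambda>x. f x + g x)"
proof -
  obtain D E where "polynomial_map_deg n D f" "polynomial_map_deg n E g"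
    using assms unfolding polynomial_map_iff_deg by blast
  then have "polynomial_map_deg n (D + E) f" "polynomial_map_deg n (D + E) g"
    by (auto elim: polynomial_map_deg_mono)
  from polynomial_map_deg_add[OF this] show ?thesis
    unfolding polynomial_map_iff_deg by blast
qed

lemma polynomial_map_mult:
  assumes "polynomial_map n f" "polynomial_map n g"
  shows "polynomial_map n (\<lambda>x. f x * g x)"
proof -
  obtain D E where "polynomial_map_deg n D f" "polynomial_map_deg n E g"
    using assms unfolding polynomial_map_iff_deg by blast
  from polynomial_map_deg_mult[OF this] show ?thesis
    unfolding polynomial_map_iff_deg by blast
qed

lemma polynomial_map_const: "polynomial_map n (\<lambda>x. r)"
  unfolding polynomial_map_iff_deg using polynomial_map_deg_const by blast

lemma polynomial_map_coordinate:
  assumes "i < n"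
  shows "polynomial_map n (\<lambda>x. x i)"
proof -
  have "x i = poly_value n {\<lambda>j. if j = i then 1 else 0} (\<lambda>_. 1) x" for x :: "nat \<Rightarrow> real"
    using assms by (simp add: poly_value_def if_distrib[of "power _"] prod.delta cong: if_cong)
  then show ?thesis
    unfolding polynomial_map_def by blast
qed

lemma polynomial_map_diff:
  assumes "polynomial_map n f" "polynomial_map n g"
  shows "polynomial_map n (\<lambda>x. f x - g x)"
  using polynomial_map_add[OF assms(1) polynomial_map_mult[OF polynomial_map_const[of n "-1"] assms(2)]]
  by simp

lemma polynomial_map_power:
  assumes "polynomial_map n f"
  shows "polynomial_map n (\<lambda>x. f x ^ k)"
  by (induction k) (auto intro: polynomial_map_const polynomial_map_mult assms)

lemma polynomial_map_sum:
  assumes "\<And>i. i \<in> I \<Longrightarrow> polynomial_map n (f i)"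
  shows "polynomial_map n (\<lambda>x. \<Sum>i\<in>I. f i x)"
  using assms
  by (induction I rule: infinite_finite_induct)
    (auto intro: polynomial_map_const polynomial_map_add)

section \<open>Algebraic dependence and the upper bound for the dimension\<close>

text \<open>
  Gaussian elimination: a homogeneous linear system with more unknowns (indexed by \<open>A\<close>) than
  equations (indexed by \<open>B\<close>) has a nonzero solution.
\<close>

lemma homogeneous_system_nontrivial_solution:
  fixes M :: "'a \<Rightarrow> 'b \<Rightarrow> real"
  assumes "finite B" "finite A" "card B < card A"
  shows "\<exists>c. (\<exists>a\<in>A. c a \<noteq> 0) \<and> (\<forall>b\<in>B. (\<Sum>a\<in>A. c a * M a b) = 0)"
  using assms
proof (induction B arbitrary: A M rule: finite_induct)
  case empty
  then obtain a where "a \<in> A"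
    by fastforce
  then show ?case
    by (intro exI[of _ "\<lambda>_. 1"]) auto
next
  case (insert b B)
  show ?case
  proof (cases "\<forall>a\<in>A. M a b = 0")
    case True
    then show ?thesis
      using insert.IH[of A M] insert.prems insert.hyps by auto
  next
    case False
    then obtain p where p: "p \<in> A" "M p b \<noteq> 0"
      by blast
    \<comment> \<open>Eliminate the unknown \<open>p\<close> by means of the equation \<open>b\<close>.\<close>
    define N where "N a b' = M a b' - M a b / M p b * M p b'" for a b'
    have "card B < card (A - {p})"
      using insert p by simp
    then obtain c where c: "\<exists>a\<in>A - {p}. c a \<noteq> 0"
      "\<And>b'. b' \<in> B \<Longrightarrow> (\<Sum>a\<in>A - {p}. c a * N a b') = 0"
      using insert.IH[of "A - {p}" N] insert.prems by auto
    define s where "s = (\<Sum>a\<in>A - {p}. c a * M a b)"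
    define c' where "c' = c(p := - s / M p b)"
    have sum: "(\<Sum>a\<in>A. c' a * M a b') = (\<Sum>a\<in>A - {p}. c a * M a b') - s / M p b * M p b'" for b'
      using p insert.prems by (subst sum.remove[of _ p]) (auto simp: c'_def intro!: sum.cong)
    have "(\<Sum>a\<in>A. c' a * M a b') = 0" if "b' \<in> B" for b'
    proof -
      have "0 = (\<Sum>a\<in>A - {p}. c a * M a b' - (c a * M a b) * (M p b' / M p b))"
        using c(2)[OF that] by (simp add: N_def algebra_simps)
      also have "\<dots> = (\<Sum>a\<in>A - {p}. c a * M a b') - s * (M p b' / M p b)"
        by (simp only: s_def sum_subtractf sum_distrib_right)
      finally show ?thesis
        unfolding sum by simp
    qed
    moreover have "(\<Sum>a\<in>A. c' a * M a b) = 0"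
      unfolding sum using p by (simp add: s_def)
    moreover have "\<exists>a\<in>A. c' a \<noteq> 0"
      using c(1) by (auto simp: c'_def)
    ultimately show ?thesis
      by blast
  qed
qed

text \<open>
  The products of powers \<open>\<Prod>\<^sub>i a\<^sub>i ^ e\<^sub>i\<close> with all \<open>e\<^sub>i \<le> E\<close> number \<open>(E + 1) ^ (n + 1)\<close>, and they all
  lie in the span of \<open>((n + 1) * E * D + 1) ^ n\<close> monomials. For large \<open>E\<close> the former number is
  bigger, which forces a linear relation.
\<close>

lemma polynomial_maps_algebraically_dependent:
  assumes "\<And>i. i < Suc n \<Longrightarrow> polynomial_map n (a i)"
  shows "\<exists>E c. (\<exists>e\<in>exponent_box (Suc n) E. c e \<noteq> 0) \<and>
    (\<forall>x. (\<Sum>e\<in>exponent_box (Suc n) E. c e * (\<Prod>i<Suc n. a i x ^ e i)) = 0)"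
proof -
  have "\<exists>D. \<forall>i<Suc n. polynomial_map_deg n D (a i)"
  proof -
    have "\<forall>i\<in>{..<Suc n}. \<exists>D. polynomial_map_deg n D (a i)"
      using assms by (auto simp: polynomial_map_iff_deg)
    then obtain D where "\<forall>i\<in>{..<Suc n}. polynomial_map_deg n (D i) (a i)"
      by metis
    moreover have "D i \<le> Max (D ` {..<Suc n})" if "i \<in> {..<Suc n}" for i
      using that by (intro Max_ge) auto
    ultimately show ?thesis
      by (meson lessThan_iff polynomial_map_deg_mono)
  qed
  then obtain D where D: "\<And>i. i < Suc n \<Longrightarrow> polynomial_map_deg n D (a i)"
    by blast
  define K where "K = Suc n * D"
  define E where "E = (K + 1) ^ n"
  have "polynomial_map_deg n (K * E) (\<lambda>x. \<Prod>i<Suc n. a i x ^ e i)"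
    if "e \<in> exponent_box (Suc n) E" for e
  proof -
    have "polynomial_map_deg n (E * D) (\<lambda>x. a i x ^ e i)" if "i < Suc n" for i
    proof (rule polynomial_map_deg_mono[OF polynomial_map_deg_power[OF D[OF that]]])
      show "e i * D \<le> E * D"
        using \<open>e \<in> _\<close> that by (auto simp: exponent_box_def PiE_iff)
    qed
    from polynomial_map_deg_prod[of "Suc n", OF this] show ?thesis
      by (simp add: K_def algebra_simps)
  qed
  then have "\<forall>e\<in>exponent_box (Suc n) E. \<exists>M. \<forall>x.
      (\<Prod>i<Suc n. a i x ^ e i) = poly_value n (exponent_box n (K * E)) M x"
    unfolding polynomial_map_deg_def by blast
  then obtain M where M: "\<And>e x. e \<in> exponent_box (Suc n) E \<Longrightarrow>
      (\<Prod>i<Suc n. a i x ^ e i) = poly_value n (exponent_box n (K * E)) (M e) x"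
    by metis
  have "(K * E + 1) ^ n \<le> ((K + 1) * (E + 1)) ^ n"
    by (intro power_mono) auto
  also have "\<dots> = E * (E + 1) ^ n"
    unfolding power_mult_distrib by (simp add: E_def)
  also have "\<dots> < (E + 1) ^ Suc n"
    by simp
  finally have "card (exponent_box n (K * E)) < card (exponent_box (Suc n) E)"
    by (simp only: card_exponent_box)
  from homogeneous_system_nontrivial_solution[OF finite_exponent_box finite_exponent_box this, of M]
  obtain c where c: "\<exists>e\<in>exponent_box (Suc n) E. c e \<noteq> 0"
    "\<And>\<beta>. \<beta> \<in> exponent_box n (K * E) \<Longrightarrow> (\<Sum>e\<in>exponent_box (Suc n) E. c e * M e \<beta>) = 0"
    by blast
  have "(\<Sum>e\<in>exponent_box (Suc n) E. c e * (\<Prod>i<Suc n. a i x ^ e i)) = 0" for x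
  proof -
    have "(\<Sum>e\<in>exponent_box (Suc n) E. c e * (\<Prod>i<Suc n. a i x ^ e i)) =
      (\<Sum>e\<in>exponent_box (Suc n) E. \<Sum>\<beta>\<in>exponent_box n (K * E). c e * M e \<beta> * (\<Prod>j<n. x j ^ \<beta> j))"
      by (intro sum.cong refl, subst M) (auto simp: poly_value_def sum_distrib_left mult.assoc)
    also have "\<dots> = (\<Sum>\<beta>\<in>exponent_box n (K * E). (\<Sum>e\<in>exponent_box (Suc n) E. c e * M e \<beta>) * (\<Prod>j<n. x j ^ \<beta> j))"
      by (subst sum.swap) (simp add: sum_distrib_right)
    also have "\<dots> = 0"
      by (intro sum.neutral) (auto simp: c)
    finally show ?thesis .
  qed
  with c(1) show ?thesis
    by blast
qed

text \<open>
  Prime ideals of a ring \<open>A\<close> of real functions are described by pointwise operations here, so that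
  polynomial expressions in their elements are ordinary finite sums and products. The empty set is
  admitted as well.
\<close>

definition prime_in :: "('b \<Rightarrow> real) set \<Rightarrow> ('b \<Rightarrow> real) set \<Rightarrow> bool"
  where "prime_in A V \<longleftrightarrow> V \<subseteq> A \<and> (\<lambda>x. 1) \<notin> V \<and>
    (\<forall>f\<in>V. \<forall>g\<in>V. (\<lambda>x. f x + g x) \<in> V) \<and>
    (\<forall>f\<in>A. \<forall>g\<in>V. (\<lambda>x. f x * g x) \<in> V) \<and>
    (\<forall>f\<in>A. \<forall>g\<in>A. (\<lambda>x. f x * g x) \<in> V \<longrightarrow> f \<in> V \<or> g \<in> V)"

lemma prime_inD:
  assumes "prime_in A V"
  shows "V \<subseteq> A" and "(\<lambda>x. 1) \<notin> V"
    and "f \<in> V \<Longrightarrow> g \<in> V \<Longrightarrow> (\<lambda>x. f x + g x) \<in> V"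
    and "f \<in> A \<Longrightarrow> g \<in> V \<Longrightarrow> (\<lambda>x. f x * g x) \<in> V"
    and "f \<in> A \<Longrightarrow> g \<in> A \<Longrightarrow> (\<lambda>x. f x * g x) \<in> V \<Longrightarrow> f \<in> V \<or> g \<in> V"
  using assms by (auto simp: prime_in_def)

text \<open>
  Elements picked successively from the gaps of a chain of primes are algebraically independent.
  Given a polynomial expression in \<open>a\<^sub>j, a\<^sub>j\<^sub>+\<^sub>1, \<dots>\<close> that lies in \<open>V\<^sub>j\<close>, the lowest occurring power of
  \<open>a\<^sub>j\<close> can be cancelled because \<open>a\<^sub>j \<notin> V\<^sub>j\<close>; the terms still divisible by \<open>a\<^sub>j \<in> V\<^sub>j\<^sub>+\<^sub>1\<close> can then be
  dropped, and what remains is an expression in \<open>a\<^sub>j\<^sub>+\<^sub>1, \<dots>\<close> that lies in \<open>V\<^sub>j\<^sub>+\<^sub>1\<close>. In the end a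
  nonzero constant lies in the last prime, which is absurd. The assumption comparing exponents on
  \<open>{j..<m}\<close> says that the monomials are pairwise different.
\<close>

lemma prime_chain_expression_notin:
  fixes A :: "('b \<Rightarrow> real) set" and a :: "nat \<Rightarrow> 'b \<Rightarrow> real"
  assumes const: "\<And>r. (\<lambda>x. r) \<in> A"
    and add: "\<And>f g. f \<in> A \<Longrightarrow> g \<in> A \<Longrightarrow> (\<lambda>x. f x + g x) \<in> A"
    and mult: "\<And>f g. f \<in> A \<Longrightarrow> g \<in> A \<Longrightarrow> (\<lambda>x. f x * g x) \<in> A"
    and prime: "\<And>i. i \<le> m \<Longrightarrow> prime_in A (V i)"
    and chain: "\<And>i. i < m \<Longrightarrow> V i \<subseteq> V (Suc i)"
    and a: "\<And>i. i < m \<Longrightarrow> a i \<in> V (Suc i) - V i"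
    and "j \<le> m" "finite F" "F \<noteq> {}"
    and "\<And>e e'. e \<in> F \<Longrightarrow> e' \<in> F \<Longrightarrow> (\<forall>i\<in>{j..<m}. e i = e' i) \<Longrightarrow> e = e'"
    and "\<And>e. e \<in> F \<Longrightarrow> c e \<noteq> 0"
  shows "(\<lambda>x. \<Sum>e\<in>F. c e * (\<Prod>i\<in>{j..<m}. a i x ^ e i)) \<notin> V j"
  using assms(7-)
proof (induction j arbitrary: F rule: inc_induct)
  case base
  then obtain e where "e \<in> F"
    by blast
  with base have F: "F = {e}"
    by auto
  show ?case
  proof
    assume "(\<lambda>x. \<Sum>e\<in>F. c e * (\<Prod>i\<in>{m..<m}. a i x ^ e i)) \<in> V m"
    then have "(\<lambda>x. c e) \<in> V m"
      by (simp add: F)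
    then have "(\<lambda>x. 1 / c e * c e) \<in> V m"
      by (rule prime_inD(4)[OF prime[OF order_refl] const])
    moreover have "c e \<noteq> 0"
      using base.prems \<open>e \<in> F\<close> by blast
    ultimately show False
      using prime_inD(2)[OF prime[OF order_refl]] by simp
  qed
next
  case (step j)
  have aA: "a i \<in> A" if "i < m" for i
    using a[OF that] prime_inD(1)[OF prime[of "Suc i"]] that by auto
  have power: "(\<lambda>x. f x ^ k) \<in> A" if "f \<in> A" for f k
    by (induction k) (simp_all add: const mult[OF that])
  have prod: "(\<lambda>x. \<Prod>i\<in>I. f i x) \<in> A" if "\<And>i. i \<in> I \<Longrightarrow> f i \<in> A" for f and I :: "nat set"
    using that by (induction I rule: infinite_finite_induct) (simp_all add: const mult)
  have sum: "(\<lambda>x. \<Sum>i\<in>I. f i x) \<in> A" if "\<And>i. i \<in> I \<Longrightarrow> f i \<in> A" for f and I :: "(nat \<Rightarrow> nat) set"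
    using that by (induction I rule: infinite_finite_induct) (simp_all add: const add)
  define T where "T e x = (\<Prod>i\<in>{Suc j..<m}. a i x ^ e i)" for e :: "nat \<Rightarrow> nat" and x
  have T: "T e \<in> A" for e
    unfolding T_def using aA by (intro prod power) auto
  define k where "k = Min ((\<lambda>e. e j) ` F)"
  have k: "k \<le> e j" if "e \<in> F" for e
    using that step.prems by (simp add: k_def)
  define F0 where "F0 = {e \<in> F. e j = k}"
  have "k \<in> (\<lambda>e. e j) ` F"
    unfolding k_def using step.prems by (intro Min_in) auto
  then have "F0 \<noteq> {}"
    by (auto simp: F0_def)
  define G where "G x = (\<Sum>e\<in>F. c e * (a j x ^ (e j - k) * T e x))" for x
  define R where "R x = (\<Sum>e\<in>F - F0. c e * (a j x ^ (e j - k - 1) * T e x))" for x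
  have GA: "G \<in> A" and RA: "R \<in> A"
    unfolding G_def R_def using \<open>j < m\<close> by (intro sum mult const power T aA; simp)+
  have jm: "j \<le> m" "Suc j \<le> m"
    using \<open>j < m\<close> by auto
  have G_notin: "(\<lambda>x. \<Sum>e\<in>F0. c e * T e x) \<notin> V (Suc j)"
    unfolding T_def
  proof (rule step.IH)
    show "e = e'" if "e \<in> F0" "e' \<in> F0" "\<forall>i\<in>{Suc j..<m}. e i = e' i" for e e'
    proof -
      have "e i = e' i" if "i \<in> {j..<m}" for i
        using that \<open>e \<in> F0\<close> \<open>e' \<in> F0\<close> \<open>\<forall>i\<in>{Suc j..<m}. e i = e' i\<close>
        by (cases "i = j") (auto simp: F0_def)
      then show ?thesis
        using step.prems(3)[of e e'] that by (auto simp: F0_def)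
    qed
  qed (use step.prems \<open>F0 \<noteq> {}\<close> in \<open>auto simp: F0_def\<close>)
  have G: "G x = (\<Sum>e\<in>F0. c e * T e x) + a j x * R x" for x
  proof -
    have "G x = (\<Sum>e\<in>F0. c e * (a j x ^ (e j - k) * T e x)) +
        (\<Sum>e\<in>F - F0. c e * (a j x ^ (e j - k) * T e x))"
      unfolding G_def using step.prems
      by (subst sum.subset_diff[of F0]) (auto simp: F0_def)
    moreover have "(\<Sum>e\<in>F0. c e * (a j x ^ (e j - k) * T e x)) = (\<Sum>e\<in>F0. c e * T e x)"
      by (intro sum.cong refl) (auto simp: F0_def)
    moreover have "(\<Sum>e\<in>F - F0. c e * (a j x ^ (e j - k) * T e x)) = a j x * R x"
      unfolding R_def sum_distrib_left
    proof (intro sum.cong refl)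
      fix e assume "e \<in> F - F0"
      then have "e j - k = Suc (e j - k - 1)"
        using k[of e] by (auto simp: F0_def)
      then have "a j x ^ (e j - k) = a j x * a j x ^ (e j - k - 1)"
        by (metis power_Suc)
      then show "c e * (a j x ^ (e j - k) * T e x) = a j x * (c e * (a j x ^ (e j - k - 1) * T e x))"
        by simp
    qed
    ultimately show ?thesis
      by simp
  qed
  have "G \<notin> V j"
  proof
    assume "G \<in> V j"
    then have "G \<in> V (Suc j)"
      using chain \<open>j < m\<close> by blast
    moreover have "(\<lambda>x. (- R x) * a j x) \<in> V (Suc j)"
    proof -
      have "(\<lambda>x. (-1) * R x) \<in> A"
        by (intro mult const RA)
      then have "(\<lambda>x. - R x) \<in> A"
        by simp
      then show ?thesis
        by (rule prime_inD(4)[OF prime[OF jm(2)]]) (use a[OF \<open>j < m\<close>] in auto)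
    qed
    ultimately have "(\<lambda>x. G x + (- R x) * a j x) \<in> V (Suc j)"
      by (rule prime_inD(3)[OF prime[OF jm(2)]])
    also have "(\<lambda>x. G x + (- R x) * a j x) = (\<lambda>x. \<Sum>e\<in>F0. c e * T e x)"
      by (auto simp: G)
    finally show False
      using G_notin by blast
  qed
  have "(\<lambda>x. a j x ^ p * G x) \<notin> V j" for p
  proof (induction p)
    case 0
    show ?case using \<open>G \<notin> V j\<close> by simp
  next
    case (Suc p)
    show ?case
    proof
      assume "(\<lambda>x. a j x ^ Suc p * G x) \<in> V j"
      then have "(\<lambda>x. a j x * (a j x ^ p * G x)) \<in> V j"
        by (simp add: mult.assoc)
      moreover have "(\<lambda>x. a j x ^ p * G x) \<in> A"
        by (intro mult power aA GA \<open>j < m\<close>)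
      ultimately have "a j \<in> V j \<or> (\<lambda>x. a j x ^ p * G x) \<in> V j"
        by (intro prime_inD(5)[OF prime[OF jm(1)] aA[OF \<open>j < m\<close>]])
      then show False
        using a[OF \<open>j < m\<close>] Suc.IH by blast
    qed
  qed
  moreover have "(\<lambda>x. \<Sum>e\<in>F. c e * (\<Prod>i\<in>{j..<m}. a i x ^ e i)) = (\<lambda>x. a j x ^ k * G x)"
  proof
    fix x
    have "c e * (\<Prod>i\<in>{j..<m}. a i x ^ e i) = a j x ^ k * (c e * (a j x ^ (e j - k) * T e x))"
      if "e \<in> F" for e
    proof -
      have "(\<Prod>i\<in>{j..<m}. a i x ^ e i) = a j x ^ e j * T e x"
        using \<open>j < m\<close> by (simp add: T_def prod.atLeast_Suc_lessThan)
      moreover have "a j x ^ e j = a j x ^ k * a j x ^ (e j - k)"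
        using k[OF that] by (simp flip: power_add)
      ultimately show ?thesis
        by simp
    qed
    then show "(\<Sum>e\<in>F. c e * (\<Prod>i\<in>{j..<m}. a i x ^ e i)) = a j x ^ k * G x"
      unfolding G_def sum_distrib_left by (intro sum.cong refl) auto
  qed
  ultimately show ?case
    by simp
qed

lemma polynomial_functions_ring_simps:
  "carrier (polynomial_functions_ring n S) = {restrict f S |f. polynomial_map n f}"
  "restrict f S \<otimes>\<^bsub>polynomial_functions_ring n S\<^esub> restrict g S = restrict (\<lambda>x. f x * g x) S"
  "restrict f S \<oplus>\<^bsub>polynomial_functions_ring n S\<^esub> restrict g S = restrict (\<lambda>x. f x + g x) S"
  "\<one>\<^bsub>polynomial_functions_ring n S\<^esub> = restrict (\<lambda>x. 1) S"
  "\<zero>\<^bsub>polynomial_functions_ring n S\<^esub> = restrict (\<lambda>x. 0) S"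
  by (auto simp: polynomial_functions_ring_def restrict_def)

lemma primeideal_imp_prime_in:
  assumes "primeideal P (polynomial_functions_ring n S)"
  shows "prime_in (Collect (polynomial_map n)) {f. polynomial_map n f \<and> restrict f S \<in> P}"
proof -
  interpret primeideal P "polynomial_functions_ring n S" by fact
  have one: "restrict (\<lambda>x. 1) S \<notin> P"
    using one_imp_carrier I_notcarr by (auto simp: polynomial_functions_ring_simps)
  have add: "restrict (\<lambda>x. f x + g x) S \<in> P" if "restrict f S \<in> P" "restrict g S \<in> P" for f g
    using additive_subgroup.a_closed[OF is_additive_subgroup that] by (simp add: polynomial_functions_ring_simps)
  have mult: "restrict (\<lambda>x. f x * g x) S \<in> P" if "polynomial_map n f" "restrict g S \<in> P" for f g
    using I_l_closed[OF that(2), of "restrict f S"] that(1)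
    by (auto simp: polynomial_functions_ring_simps)
  have prime: "restrict f S \<in> P \<or> restrict g S \<in> P"
    if "polynomial_map n f" "polynomial_map n g" "restrict (\<lambda>x. f x * g x) S \<in> P" for f g
    using I_prime[of "restrict f S" "restrict g S"] that
    by (auto simp: polynomial_functions_ring_simps)
  show ?thesis
    unfolding prime_in_def using one add mult prime
    by (auto intro: polynomial_map_add polynomial_map_mult)
qed

text \<open>
  A chain of \<open>n + 2\<close> primes would provide \<open>n + 1\<close> polynomials in \<open>n\<close> variables that are
  algebraically independent even modulo the smallest prime of the chain.
\<close>

lemma semialgebraic_dim_le: "semialgebraic_dim n S \<le> ereal (real n)"
proof -
  let ?R = "polynomial_functions_ring n S"
  have False if "prime_chain ?R k P" "k > n" for k P
  proof -
    define V where "V i = {f. polynomial_map n f \<and> restrict f S \<in> P i}" for i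
    have P: "primeideal (P i) ?R" if "i \<le> Suc n" for i
      using \<open>prime_chain ?R k P\<close> \<open>k > n\<close> that by (auto simp: prime_chain_def)
    have P_less: "P i \<subset> P (Suc i)" if "i < Suc n" for i
      using \<open>prime_chain ?R k P\<close> \<open>k > n\<close> that by (auto simp: prime_chain_def)
    have prime: "prime_in (Collect (polynomial_map n)) (V i)" if "i \<le> Suc n" for i
      unfolding V_def by (rule primeideal_imp_prime_in[OF P[OF that]])
    have chain: "V i \<subseteq> V (Suc i)" if "i < Suc n" for i
      using P_less[OF that] by (auto simp: V_def)
    have "\<exists>f. f \<in> V (Suc i) - V i" if "i < Suc n" for i
    proof -
      have "P i \<subset> P (Suc i)"
        by (rule P_less[OF that])
      then obtain g where g: "g \<in> P (Suc i)" "g \<notin> P i"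
        by blast
      interpret primeideal "P (Suc i)" ?R
        using P that by simp
      obtain f where "polynomial_map n f" "g = restrict f S"
        using Icarr[OF g(1)] by (auto simp: polynomial_functions_ring_simps)
      then have "f \<in> V (Suc i) - V i"
        using g by (simp add: V_def)
      then show ?thesis
        by blast
    qed
    then obtain a where a: "\<And>i. i < Suc n \<Longrightarrow> a i \<in> V (Suc i) - V i"
      by metis
    then have "polynomial_map n (a i)" if "i < Suc n" for i
      using that by (auto simp: V_def)
    then obtain E c where c: "\<exists>e\<in>exponent_box (Suc n) E. c e \<noteq> 0"
      and rel: "\<And>x. (\<Sum>e\<in>exponent_box (Suc n) E. c e * (\<Prod>i<Suc n. a i x ^ e i)) = 0"
      using polynomial_maps_algebraically_dependent[of n a] by blast
    let ?F = "{e \<in> exponent_box (Suc n) E. c e \<noteq> 0}"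
    have "(\<lambda>x. \<Sum>e\<in>?F. c e * (\<Prod>i\<in>{0..<Suc n}. a i x ^ e i)) \<notin> V 0"
    proof (rule prime_chain_expression_notin[where A = "Collect (polynomial_map n)"
          and V = V and a = a and m = "Suc n" and j = 0, OF _ _ _ prime chain a])
      show "e = e'" if "e \<in> ?F" "e' \<in> ?F" "\<forall>i\<in>{0..<Suc n}. e i = e' i" for e e'
        using that unfolding exponent_box_def
        by (intro PiE_ext[of e "{..<Suc n}" "\<lambda>_. {..E}" e']) auto
    qed (use c in \<open>auto simp: finite_exponent_box intro: polynomial_map_const polynomial_map_add polynomial_map_mult\<close>)
    moreover have "(\<Sum>e\<in>?F. c e * (\<Prod>i\<in>{0..<Suc n}. a i x ^ e i)) =
        (\<Sum>e\<in>exponent_box (Suc n) E. c e * (\<Prod>i<Suc n. a i x ^ e i))" for x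
      unfolding atLeast0LessThan by (intro sum.mono_neutral_left finite_exponent_box) auto
    ultimately have "(\<lambda>x. 0) \<notin> V 0"
      by (simp only: rel not_False_eq_True)
    moreover have "\<zero>\<^bsub>?R\<^esub> \<in> P 0"
    proof -
      interpret primeideal "P 0" ?R
        using P by simp
      show ?thesis
        by (rule additive_subgroup.zero_closed[OF is_additive_subgroup])
    qed
    ultimately show False
      by (simp add: V_def polynomial_functions_ring_simps polynomial_map_const)
  qed
  then show ?thesis
    unfolding semialgebraic_dim_def krull_dim_def by (intro SUP_least) force
qed

section \<open>Vanishing ideals of convex sets and the lower bound for the dimension\<close>

lemma polynomial_map_on_line:
  assumes "polynomial_map n f"
  shows "\<exists>p :: real poly. \<forall>t. f (\<lambda>j. (1 - t) * x j + t * y j) = poly p t"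
proof -
  obtain A c where f: "\<And>x. f x = poly_value n A c x"
    using assms by (auto simp: polynomial_map_def)
  have "f (\<lambda>j. (1 - t) * x j + t * y j) =
      poly (\<Sum>\<alpha>\<in>A. Polynomial.smult (c \<alpha>) (\<Prod>j<n. [:x j, y j - x j:] ^ \<alpha> j)) t" for t
    unfolding f poly_value_def poly_sum poly_smult poly_prod poly_power
    by (simp add: algebra_simps)
  then show ?thesis
    by blast
qed

lemma polynomial_functions_carrierI:
  "polynomial_map n f \<Longrightarrow> restrict f S \<in> carrier (polynomial_functions_ring n S)"
  by (auto simp: polynomial_functions_ring_simps)

lemma polynomial_functions_carrierE:
  assumes "f \<in> carrier (polynomial_functions_ring n S)"
  obtains g where "polynomial_map n g" "f = restrict g S"
  using assms by (auto simp: polynomial_functions_ring_simps)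

lemma polynomial_functions_cring: "cring (polynomial_functions_ring n S)"
proof (rule cringI)
  let ?R = "polynomial_functions_ring n S"
  note intros = polynomial_functions_carrierI polynomial_map_add polynomial_map_mult
    polynomial_map_const
  note elim = polynomial_functions_carrierE
  note simps = polynomial_functions_ring_simps(2-)
  show "abelian_group ?R"
  proof (rule abelian_groupI)
    fix f assume "f \<in> carrier ?R"
    then obtain g where g: "polynomial_map n g" "f = restrict g S"
      by (rule elim)
    then have "restrict (\<lambda>x. 0 - g x) S \<oplus>\<^bsub>?R\<^esub> f = \<zero>\<^bsub>?R\<^esub>"
      by (simp add: simps)
    moreover have "restrict (\<lambda>x. 0 - g x) S \<in> carrier ?R"
      using g(1) by (intro polynomial_functions_carrierI polynomial_map_diff polynomial_map_const)
    ultimately show "\<exists>h\<in>carrier ?R. h \<oplus>\<^bsub>?R\<^esub> f = \<zero>\<^bsub>?R\<^esub>"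
      by blast
  qed (auto elim!: elim simp: simps add_ac intro!: intros)
  show "comm_monoid ?R"
    by (rule comm_monoidI) (auto elim!: elim simp: simps mult_ac intro!: intros)
qed (auto elim!: polynomial_functions_carrierE simp: polynomial_functions_ring_simps(2-) distrib_right)

definition vanishing_ideal ::
    "nat \<Rightarrow> (nat \<Rightarrow> real) set \<Rightarrow> (nat \<Rightarrow> real) set \<Rightarrow> ((nat \<Rightarrow> real) \<Rightarrow> real) set"
  where "vanishing_ideal n S Z = {restrict f S |f. polynomial_map n f \<and> (\<forall>x\<in>Z. f x = 0)}"

lemma restrict_in_vanishing_ideal_iff:
  assumes "Z \<subseteq> S" "polynomial_map n f"
  shows "restrict f S \<in> vanishing_ideal n S Z \<longleftrightarrow> (\<forall>x\<in>Z. f x = 0)"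
proof
  assume "restrict f S \<in> vanishing_ideal n S Z"
  then obtain g where g: "restrict f S = restrict g S" "\<forall>x\<in>Z. g x = 0"
    by (auto simp: vanishing_ideal_def)
  show "\<forall>x\<in>Z. f x = 0"
    using g assms(1) by (metis restrict_apply' subsetD)
qed (use assms in \<open>auto simp: vanishing_ideal_def\<close>)

text \<open>
  If \<open>f\<close> and \<open>g\<close> do not vanish at points \<open>p\<close> and \<open>q\<close> of \<open>Z\<close>, their restrictions to the segment
  from \<open>p\<close> to \<open>q\<close> are nonzero polynomials in one variable, so that \<open>f * g\<close> has only finitely many
  zeros on this segment.
\<close>

lemma vanishing_ideal_prime:
  assumes "Z \<subseteq> S" "Z \<noteq> {}"
    and convex: "\<And>x y t. x \<in> Z \<Longrightarrow> y \<in> Z \<Longrightarrow> 0 \<le> t \<Longrightarrow> t \<le> 1 \<Longrightarrow> (\<lambda>j. (1 - t) * x j + t * y j) \<in> Z"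
  shows "primeideal (vanishing_ideal n S Z) (polynomial_functions_ring n S)"
proof -
  let ?R = "polynomial_functions_ring n S"
  let ?I = "vanishing_ideal n S Z"
  interpret cring ?R by (rule polynomial_functions_cring)
  note iff = restrict_in_vanishing_ideal_iff[OF \<open>Z \<subseteq> S\<close>]
  have I: "?I \<subseteq> carrier ?R"
    by (auto simp: vanishing_ideal_def polynomial_functions_ring_simps)
  have mult: "f \<otimes>\<^bsub>?R\<^esub> g \<in> ?I" if f: "f \<in> ?I" and g: "g \<in> carrier ?R" for f g
  proof -
    obtain f' where f': "f = restrict f' S" "polynomial_map n f'" "\<forall>x\<in>Z. f' x = 0"
      using f unfolding vanishing_ideal_def by blast
    obtain g' where g': "g = restrict g' S" "polynomial_map n g'"
      using g by (rule polynomial_functions_carrierE)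
    show ?thesis
      using f' g' by (simp add: polynomial_functions_ring_simps iff polynomial_map_mult)
  qed
  have "ideal ?I ?R"
  proof (rule idealI)
    show "Ring.ring ?R" by (rule ring_axioms)
    show "subgroup ?I (add_monoid ?R)"
    proof (rule add.subgroupI)
      show "?I \<noteq> {}"
        using iff[OF polynomial_map_const, of 0] by auto
      show "f \<oplus>\<^bsub>?R\<^esub> g \<in> ?I" if fg: "f \<in> ?I" "g \<in> ?I" for f g
      proof -
        obtain f' g' where "f = restrict f' S" "polynomial_map n f'" "\<forall>x\<in>Z. f' x = 0"
          "g = restrict g' S" "polynomial_map n g'" "\<forall>x\<in>Z. g' x = 0"
          using fg unfolding vanishing_ideal_def by blast
        then show ?thesis
          by (simp add: polynomial_functions_ring_simps iff polynomial_map_add)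
      qed
      show "\<ominus>\<^bsub>?R\<^esub> f \<in> ?I" if "f \<in> ?I" for f
      proof -
        have "f \<otimes>\<^bsub>?R\<^esub> (\<ominus>\<^bsub>?R\<^esub> \<one>\<^bsub>?R\<^esub>) \<in> ?I"
          using that by (intro mult) auto
        moreover have "f \<otimes>\<^bsub>?R\<^esub> (\<ominus>\<^bsub>?R\<^esub> \<one>\<^bsub>?R\<^esub>) = \<ominus>\<^bsub>?R\<^esub> f"
          using that I by (simp add: r_minus subset_iff)
        ultimately show ?thesis by simp
      qed
    qed (use I in auto)
    show "f \<otimes>\<^bsub>?R\<^esub> g \<in> ?I" if "f \<in> ?I" "g \<in> carrier ?R" for f g
      by (rule mult[OF that])
    show "g \<otimes>\<^bsub>?R\<^esub> f \<in> ?I" if "f \<in> ?I" "g \<in> carrier ?R" for f g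
      using mult[OF that] that I by (simp add: m_comm subset_iff)
  qed
  then show ?thesis
  proof (rule primeidealI)
    have "restrict (\<lambda>x. 1) S \<notin> ?I"
      using \<open>Z \<noteq> {}\<close> by (auto simp: iff polynomial_map_const)
    then show "carrier ?R \<noteq> ?I"
      using one_closed by (auto simp: polynomial_functions_ring_simps)
    fix f g assume fg: "f \<in> carrier ?R" "g \<in> carrier ?R" "f \<otimes>\<^bsub>?R\<^esub> g \<in> ?I"
    obtain f' where f': "f = restrict f' S" "polynomial_map n f'"
      using fg(1) by (auto simp: polynomial_functions_ring_simps)
    obtain g' where g': "g = restrict g' S" "polynomial_map n g'"
      using fg(2) by (auto simp: polynomial_functions_ring_simps)
    have zero: "f' x * g' x = 0" if "x \<in> Z" for x
      using fg(3) f' g' that by (auto simp: polynomial_functions_ring_simps iff polynomial_map_mult)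
    show "f \<in> ?I \<or> g \<in> ?I"
    proof (rule ccontr)
      assume "\<not> ?thesis"
      then obtain x y where xy: "x \<in> Z" "f' x \<noteq> 0" "y \<in> Z" "g' y \<noteq> 0"
        using f' g' by (auto simp: iff)
      obtain p q where p: "\<And>t. f' (\<lambda>j. (1 - t) * x j + t * y j) = poly p t"
        and q: "\<And>t. g' (\<lambda>j. (1 - t) * x j + t * y j) = poly q t"
        using polynomial_map_on_line f'(2) g'(2) by metis
      have "p \<noteq> 0" "q \<noteq> 0"
        using p[of 0] q[of 1] xy by auto
      then have "finite {t. poly (p * q) t = 0}"
        by (intro poly_roots_finite) simp
      moreover have "{0..1} \<subseteq> {t. poly (p * q) t = 0}"
      proof
        fix t :: real assume "t \<in> {0..1}"
        then have "f' (\<lambda>j. (1 - t) * x j + t * y j) * g' (\<lambda>j. (1 - t) * x j + t * y j) = 0"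
          by (intro zero convex xy) auto
        then show "t \<in> {t. poly (p * q) t = 0}"
          by (simp only: p q poly_mult mem_Collect_eq)
      qed
      ultimately have "finite {0..1::real}"
        by (rule rev_finite_subset)
      then show False
        using infinite_Icc[of "0::real" 1] by simp
    qed
  qed (rule polynomial_functions_cring)
qed

text \<open>
  Cutting \<open>S\<close> successively with the coordinate hyperplanes gives \<open>n + 1\<close> convex sets, whose
  vanishing ideals form a chain; the coordinate \<open>x\<^sub>i\<close> distinguishes consecutive members because
  \<open>S\<close> contains a nonzero point of the \<open>i\<close>-th axis.
\<close>

lemma semialgebraic_dim_convex:
  assumes zero: "(\<lambda>j. 0) \<in> S"
    and axis: "\<And>i. i < n \<Longrightarrow> \<exists>r. r \<noteq> 0 \<and> (\<lambda>j. if j = i then r else 0) \<in> S"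
    and convex: "\<And>x y t. x \<in> S \<Longrightarrow> y \<in> S \<Longrightarrow> 0 \<le> t \<Longrightarrow> t \<le> 1 \<Longrightarrow> (\<lambda>j. (1 - t) * x j + t * y j) \<in> S"
  shows "semialgebraic_dim n S = ereal (real n)"
proof (rule antisym[OF semialgebraic_dim_le])
  define Z where "Z i = {x \<in> S. \<forall>j<i. x j = 0}" for i :: nat
  have "prime_chain (polynomial_functions_ring n S) n (\<lambda>i. vanishing_ideal n S (Z i))"
    unfolding prime_chain_def
  proof (intro conjI allI impI)
    show "primeideal (vanishing_ideal n S (Z i)) (polynomial_functions_ring n S)" for i
      using zero convex by (intro vanishing_ideal_prime) (auto simp: Z_def)
    fix i assume "i < n"
    have Z: "Z j \<subseteq> S" for j
      by (auto simp: Z_def)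
    obtain r where r: "r \<noteq> 0" "(\<lambda>j. if j = i then r else 0) \<in> S"
      using axis[OF \<open>i < n\<close>] by blast
    have "restrict (\<lambda>x. x i) S \<in> vanishing_ideal n S (Z (Suc i))"
      unfolding restrict_in_vanishing_ideal_iff[OF Z polynomial_map_coordinate[OF \<open>i < n\<close>]]
      by (simp add: Z_def)
    moreover have "restrict (\<lambda>x. x i) S \<notin> vanishing_ideal n S (Z i)"
      unfolding restrict_in_vanishing_ideal_iff[OF Z polynomial_map_coordinate[OF \<open>i < n\<close>]]
      using r by (auto simp: Z_def intro!: bexI[of _ "\<lambda>j. if j = i then r else 0"])
    moreover have "vanishing_ideal n S (Z i) \<subseteq> vanishing_ideal n S (Z (Suc i))"
      by (auto simp: vanishing_ideal_def Z_def)
    ultimately show "vanishing_ideal n S (Z i) \<subset> vanishing_ideal n S (Z (Suc i))"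
      by blast
  qed
  then show "ereal (real n) \<le> semialgebraic_dim n S"
    unfolding semialgebraic_dim_def krull_dim_def by (intro SUP_upper) blast
qed

section \<open>Products of balls and the folding map\<close>

text \<open>
  A labelling \<open>b\<close> of the coordinates groups them into clusters; the product of balls of radius
  \<open>r\<close>, one for each cluster, does not refer to any order of the coordinates.
\<close>

definition cluster_sq :: "nat \<Rightarrow> (nat \<Rightarrow> nat) \<Rightarrow> nat \<Rightarrow> (nat \<Rightarrow> real) \<Rightarrow> real"
  where "cluster_sq n b i x = (\<Sum>j | j < n \<and> b j = i. (x j)\<^sup>2)"

definition multiball :: "nat \<Rightarrow> (nat \<Rightarrow> nat) \<Rightarrow> real \<Rightarrow> (nat \<Rightarrow> real) set"
  where "multiball n b r = {x \<in> Rn n. \<forall>k<n. cluster_sq n b (b k) x \<le> r\<^sup>2}"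

lemma cluster_sq_nonneg: "0 \<le> cluster_sq n b i x"
  unfolding cluster_sq_def by (intro sum_nonneg) auto

lemma cluster_sq_scaled:
  assumes "\<And>j. j < n \<Longrightarrow> b j = i \<Longrightarrow> y j = c * x j"
  shows "cluster_sq n b i y = c\<^sup>2 * cluster_sq n b i x"
  unfolding cluster_sq_def sum_distrib_left using assms
  by (intro sum.cong refl) (auto simp: power_mult_distrib)

lemma cluster_sq_le_sum: "cluster_sq n b i x \<le> (\<Sum>j<n. (x j)\<^sup>2)"
  unfolding cluster_sq_def by (intro sum_mono2) auto

lemma square_le_cluster_sq:
  assumes "k < n"
  shows "(x k)\<^sup>2 \<le> cluster_sq n b (b k) x"
  unfolding cluster_sq_def using assms by (intro member_le_sum) auto

lemma polynomial_map_cluster_sq: "polynomial_map n (cluster_sq n b i)"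
  unfolding cluster_sq_def[abs_def]
  by (intro polynomial_map_sum polynomial_map_power polynomial_map_coordinate) auto

lemma cluster_sq_segment:
  assumes "0 \<le> t" "t \<le> 1"
  shows "cluster_sq n b i (\<lambda>j. (1 - t) * x j + t * y j)
    \<le> (1 - t) * cluster_sq n b i x + t * cluster_sq n b i y"
proof -
  have "((1 - t) * u + t * v)\<^sup>2 \<le> (1 - t) * u\<^sup>2 + t * v\<^sup>2" for u v
  proof -
    have "0 \<le> t * (1 - t) * (u - v)\<^sup>2"
      using assms by simp
    then show ?thesis
      by (simp add: power2_eq_square algebra_simps)
  qed
  then show ?thesis
    unfolding cluster_sq_def sum_distrib_left by (subst sum.distrib[symmetric]) (intro sum_mono)
qed

lemma multiball_convex:
  assumes "x \<in> multiball n b r" "y \<in> multiball n b r" "0 \<le> t" "t \<le> 1"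
  shows "(\<lambda>j. (1 - t) * x j + t * y j) \<in> multiball n b r"
proof -
  have "cluster_sq n b (b k) (\<lambda>j. (1 - t) * x j + t * y j) \<le> r\<^sup>2" if "k < n" for k
  proof -
    have "cluster_sq n b (b k) (\<lambda>j. (1 - t) * x j + t * y j)
        \<le> (1 - t) * cluster_sq n b (b k) x + t * cluster_sq n b (b k) y"
      by (rule cluster_sq_segment[OF assms(3,4)])
    also have "\<dots> \<le> (1 - t) * r\<^sup>2 + t * r\<^sup>2"
      using assms that by (intro add_mono mult_left_mono) (auto simp: multiball_def)
    finally show ?thesis
      by (simp add: algebra_simps)
  qed
  then show ?thesis
    using assms by (auto simp: multiball_def topspace_Euclidean_space)
qed

text \<open>
  On a cluster of norm \<open>u\<close> the folding map acts as a dilation that changes the norm to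
  \<open>\<bar>3 * u - 4 * u ^ 3\<bar>\<close>. As \<open>3 * sin \<theta> - 4 * sin \<theta> ^ 3 = sin (3 * \<theta>)\<close>, it maps the unit ball
  into itself and already covers a ball of radius \<open>r \<le> 1\<close> by the ball of radius \<open>r / 2\<close>.
\<close>

definition fold_map :: "nat \<Rightarrow> (nat \<Rightarrow> nat) \<Rightarrow> (nat \<Rightarrow> real) \<Rightarrow> nat \<Rightarrow> real"
  where "fold_map n b x = (\<lambda>k. x k * (3 - 4 * cluster_sq n b (b k) x))"

lemma cluster_sq_fold_map:
  "cluster_sq n b i (fold_map n b x) = (3 - 4 * cluster_sq n b i x)\<^sup>2 * cluster_sq n b i x"
  by (rule cluster_sq_scaled) (simp add: fold_map_def)

lemma fold_map_in_multiball:
  assumes "x \<in> multiball n b 1"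
  shows "fold_map n b x \<in> multiball n b 1"
proof -
  have "cluster_sq n b (b k) (fold_map n b x) \<le> 1" if "k < n" for k
  proof -
    define q where "q = cluster_sq n b (b k) x"
    have "q \<le> 1"
      using assms that by (simp add: multiball_def q_def)
    then have "0 \<le> (1 - q) * (1 - 4 * q)\<^sup>2"
      by simp
    also have "\<dots> = 1 - (3 - 4 * q)\<^sup>2 * q"
      by (simp add: power2_eq_square algebra_simps)
    finally show ?thesis
      by (simp add: cluster_sq_fold_map q_def)
  qed
  then show ?thesis
    using assms by (auto simp: multiball_def fold_map_def topspace_Euclidean_space)
qed

lemma multiball_half_fold_map_onto:
  assumes y: "y \<in> multiball n b r" and r: "0 \<le> r" "r \<le> 1"
  obtains x where "x \<in> multiball n b (r / 2)" "fold_map n b x = y"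
proof -
  have r2: "r\<^sup>2 \<le> 1"
    using r by (simp add: power_le_one)
  \<comment> \<open>The preimage arises by contracting each cluster of \<open>y\<close> with a suitable factor; for a cluster
    with square norm \<open>q\<close> the intermediate value theorem provides it.\<close>
  have ex: "\<exists>s. 0 \<le> s \<and> s \<le> 1 / 2 \<and> s * (3 - 4 * s\<^sup>2 * q) = 1" if "q \<le> 1" for q :: real
  proof -
    let ?f = "\<lambda>s. s * (3 - 4 * s\<^sup>2 * q)"
    have "\<exists>s\<ge>0. s \<le> 1 / 2 \<and> ?f s = 1"
    proof (rule IVT')
      show "1 \<le> ?f (1 / 2)"
        using that by (simp add: power2_eq_square)
      show "continuous_on {0..1 / 2} ?f"
        by (intro continuous_intros)
    qed auto
    then show ?thesis
      by blast
  qed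
  define s where "s q = (SOME s. 0 \<le> s \<and> s \<le> 1 / 2 \<and> s * (3 - 4 * s\<^sup>2 * q) = 1)" for q :: real
  have s: "0 \<le> s q" "s q \<le> 1 / 2" "s q * (3 - 4 * (s q)\<^sup>2 * q) = 1" if "q \<le> 1" for q
    using someI_ex[OF ex[OF that]] unfolding s_def by blast+
  define Q where "Q k = cluster_sq n b (b k) y" for k
  have Q: "Q k \<le> r\<^sup>2" if "k < n" for k
    using y that by (simp add: multiball_def Q_def)
  define x where "x k = s (Q k) * y k" for k
  have x: "cluster_sq n b (b k) x = (s (Q k))\<^sup>2 * Q k" for k
    unfolding Q_def[of k] by (rule cluster_sq_scaled) (simp add: x_def Q_def)
  have "x \<in> multiball n b (r / 2)"
  proof -
    have "cluster_sq n b (b k) x \<le> (r / 2)\<^sup>2" if "k < n" for k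
    proof -
      have "Q k \<le> 1"
        using Q[OF that] r2 by simp
      then have "(s (Q k))\<^sup>2 \<le> (1 / 2)\<^sup>2"
        by (intro power_mono s)
      then have "(s (Q k))\<^sup>2 * Q k \<le> (1 / 2)\<^sup>2 * r\<^sup>2"
        using Q[OF that] by (intro mult_mono) (auto simp: Q_def cluster_sq_nonneg)
      then show ?thesis
        by (simp add: x power_divide)
    qed
    then show ?thesis
      using y by (auto simp: multiball_def x_def topspace_Euclidean_space)
  qed
  moreover have "fold_map n b x k = y k" for k
  proof (cases "k < n")
    case True
    then have "Q k \<le> 1"
      using Q[OF True] r2 by simp
    have "fold_map n b x k = y k * (s (Q k) * (3 - 4 * (s (Q k))\<^sup>2 * Q k))"
      by (simp add: fold_map_def x x_def mult_ac)
    then show ?thesis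
      using s(3)[OF \<open>Q k \<le> 1\<close>] by simp
  next
    case False
    then show ?thesis
      using y by (simp add: fold_map_def x_def multiball_def topspace_Euclidean_space)
  qed
  ultimately show thesis
    by (intro that) auto
qed

lemma funpow_fold_map_in_multiball:
  assumes "x \<in> multiball n b 1"
  shows "(fold_map n b ^^ m) x \<in> multiball n b 1"
  by (induction m) (auto intro: fold_map_in_multiball assms)

lemma funpow_fold_map_onto:
  assumes "y \<in> multiball n b 1"
  shows "\<exists>x\<in>multiball n b ((1 / 2) ^ m). (fold_map n b ^^ m) x = y"
proof (induction m)
  case 0
  show ?case
    using assms by auto
next
  case (Suc m)
  then obtain x where x: "x \<in> multiball n b ((1 / 2) ^ m)" "(fold_map n b ^^ m) x = y"
    by blast
  obtain z where z: "z \<in> multiball n b ((1 / 2) ^ m / 2)" "fold_map n b z = x"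
    using multiball_half_fold_map_onto[OF x(1)] by (auto simp: power_le_one)
  then have "(fold_map n b ^^ Suc m) z = y"
    using x(2) by (simp add: funpow_Suc_right del: funpow.simps)
  with z(1) show ?case
    by (intro bexI[of _ z]) auto
qed

lemma polynomial_map_funpow_fold_map:
  assumes "k < n"
  shows "polynomial_map n (\<lambda>x. (fold_map n b ^^ m) x k)"
  using assms
proof (induction m arbitrary: k)
  case 0
  then show ?case
    by (simp add: polynomial_map_coordinate)
next
  case (Suc m)
  show ?case
    unfolding funpow.simps comp_def fold_map_def cluster_sq_def
    by (intro polynomial_map_mult polynomial_map_diff polynomial_map_sum polynomial_map_power
        polynomial_map_const; unfold fold_map_def[symmetric] cluster_sq_def[symmetric])
      (use Suc in auto)
qed

lemma closed_unit_ball_iff: "x \<in> closed_unit_ball n \<longleftrightarrow> x \<in> Rn n \<and> (\<Sum>j<n. (x j)\<^sup>2) \<le> 1"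
  by (auto simp: closed_unit_ball_def L2_set_def)

lemma closed_unit_ball_subset_multiball: "closed_unit_ball n \<subseteq> multiball n b 1"
  by (auto simp: closed_unit_ball_iff multiball_def intro: order_trans[OF cluster_sq_le_sum])

text \<open>All \<open>n\<close> coordinates are bounded by \<open>(1 / 2) ^ n\<close>, and \<open>n * (1 / 4) ^ n \<le> 1\<close>.\<close>

lemma multiball_small_subset_closed_unit_ball:
  "multiball n b ((1 / 2) ^ n) \<subseteq> closed_unit_ball n"
proof
  fix x assume x: "x \<in> multiball n b ((1 / 2) ^ n)"
  have "(\<Sum>k<n. (x k)\<^sup>2) \<le> (\<Sum>k<n. ((1 / 2) ^ n)\<^sup>2)"
  proof (intro sum_mono)
    fix k assume "k \<in> {..<n}"
    then show "(x k)\<^sup>2 \<le> ((1 / 2) ^ n)\<^sup>2"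
      using x square_le_cluster_sq[of k n x b] by (auto simp: multiball_def)
  qed
  also have "\<dots> = real n * (1 / 2) ^ n * (1 / 2) ^ n"
    by (simp add: power2_eq_square)
  also have "\<dots> \<le> 1 * 1"
    using of_nat_less_two_power[of n, where 'a = real]
    by (intro mult_mono) (auto simp: power_one_over field_simps)
  finally show "x \<in> closed_unit_ball n"
    using x by (simp add: closed_unit_ball_iff multiball_def)
qed

text \<open>
  Iterating the folding map \<open>n\<close> times blows the product of balls of radius \<open>(1 / 2) ^ n\<close> up to the
  full product of unit balls, and the unit ball of the whole space lies between the two products.
\<close>

lemma funpow_fold_map_image_closed_unit_ball:
  "(fold_map n b ^^ n) ` closed_unit_ball n = multiball n b 1"
proof
  show "(fold_map n b ^^ n) ` closed_unit_ball n \<subseteq> multiball n b 1"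
    using closed_unit_ball_subset_multiball funpow_fold_map_in_multiball by blast
  show "multiball n b 1 \<subseteq> (fold_map n b ^^ n) ` closed_unit_ball n"
    using funpow_fold_map_onto[of _ n b n] multiball_small_subset_closed_unit_ball by fastforce
qed

section \<open>Products of balls are bricks\<close>

lemma semialgebraic_Rn: "semialgebraic n (Rn n)"
  using semialgebraic.positive[OF polynomial_map_const, of n 1] by simp

lemma semialgebraic_polynomial_inequalities:
  fixes m :: nat
  assumes "\<And>k. k < m \<Longrightarrow> polynomial_map n (f k)"
  shows "semialgebraic n {x \<in> Rn n. \<forall>k<m. f k x \<le> 0}"
  using assms
proof (induction m)
  case 0
  show ?case
    by (simp add: semialgebraic_Rn)
next
  case (Suc m)
  have "semialgebraic n ({x \<in> Rn n. \<forall>k<m. f k x \<le> 0} \<inter> (Rn n - {x \<in> Rn n. f m x > 0}))"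
    using Suc by (intro semialgebraic.intros) auto
  also have "{x \<in> Rn n. \<forall>k<m. f k x \<le> 0} \<inter> (Rn n - {x \<in> Rn n. f m x > 0}) =
      {x \<in> Rn n. \<forall>k<Suc m. f k x \<le> 0}"
    by (auto simp: less_Suc_eq not_less)
  finally show ?case .
qed

lemma semialgebraic_multiball: "semialgebraic n (multiball n b r)"
proof -
  have "multiball n b r = {x \<in> Rn n. \<forall>k<n. cluster_sq n b (b k) x - r\<^sup>2 \<le> 0}"
    by (simp add: multiball_def)
  then show ?thesis
    by (simp only:) (intro semialgebraic_polynomial_inequalities polynomial_map_diff
        polynomial_map_cluster_sq polynomial_map_const)
qed

lemma continuous_map_polynomial_map:
  assumes "polynomial_map n f"
  shows "continuous_map (Euclidean_space n) euclideanreal f"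
proof -
  obtain A c where "finite A" and f: "f = (\<lambda>x. \<Sum>\<alpha>\<in>A. c \<alpha> * (\<Prod>j<n. x j ^ \<alpha> j))"
    using assms by (auto simp: polynomial_map_def poly_value_def)
  have "continuous_map (Euclidean_space n) euclideanreal (\<lambda>x. x j)" for j
    unfolding Euclidean_space_def
    by (intro continuous_map_from_subtopology continuous_map_product_projection) simp
  then show ?thesis
    unfolding f using \<open>finite A\<close>
    by (intro continuous_map_sum continuous_map_real_mult continuous_map_prod
        continuous_map_real_pow continuous_map_canonical_const) auto
qed

lemma open_multiball_subset_interior:
  "{x \<in> Rn n. \<forall>k<n. cluster_sq n b (b k) x < 1} \<subseteq> Euclidean_space n interior_of multiball n b 1"
proof (rule interior_of_maximal)
  show "{x \<in> Rn n. \<forall>k<n. cluster_sq n b (b k) x < 1} \<subseteq> multiball n b 1"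
    by (auto simp: multiball_def intro: less_imp_le)
  have "openin (Euclidean_space n) {x \<in> Rn n. cluster_sq n b (b k) x \<in> {..<1}}" for k
    by (rule openin_continuous_map_preimage)
      (auto intro: continuous_map_polynomial_map polynomial_map_cluster_sq)
  then have "openin (Euclidean_space n)
      ((\<Inter>k\<in>{..<n}. {x \<in> Rn n. cluster_sq n b (b k) x \<in> {..<1}}) \<inter> Rn n)"
    by (intro openin_INT) auto
  also have "(\<Inter>k\<in>{..<n}. {x \<in> Rn n. cluster_sq n b (b k) x \<in> {..<1}}) \<inter> Rn n =
      {x \<in> Rn n. \<forall>k<n. cluster_sq n b (b k) x < 1}"
    by auto
  finally show "openin (Euclidean_space n) {x \<in> Rn n. \<forall>k<n. cluster_sq n b (b k) x < 1}" .
qed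

lemma multiball_dim: "semialgebraic_dim n (multiball n b 1) = ereal (real n)"
proof (rule semialgebraic_dim_convex)
  show "(\<lambda>j. 0) \<in> multiball n b 1"
    by (simp add: multiball_def cluster_sq_def topspace_Euclidean_space)
  fix i assume "i < n"
  have "(\<Sum>j<n. (if j = i then 1 else 0 :: real)\<^sup>2) = (\<Sum>j<n. if j = i then 1 else 0)"
    by (intro sum.cong) auto
  then have "(\<lambda>j. if j = i then 1 else 0) \<in> closed_unit_ball n"
    using \<open>i < n\<close> by (auto simp: closed_unit_ball_iff topspace_Euclidean_space)
  then show "\<exists>r. r \<noteq> 0 \<and> (\<lambda>j. if j = i then r else 0) \<in> multiball n b 1"
    using closed_unit_ball_subset_multiball by (intro exI[of _ 1]) auto
qed (rule multiball_convex)

text \<open>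
  A polynomial surjection from the ball onto a product of balls extends to the required homotopy by
  shrinking the product linearly to the origin, since every proper contraction of it lies in its
  interior.
\<close>

lemma multiball_brick: "brick n n (multiball n b 1)"
proof -
  let ?T = "multiball n b 1"
  let ?B = "closed_unit_ball n"
  define F where "F = fold_map n b ^^ n"
  define H where "H t x = (\<lambda>k. (1 - t) * F x k)" for t :: real and x
  have F: "F x \<in> ?T" if "x \<in> ?B" for x
    using that funpow_fold_map_image_closed_unit_ball[of n b] by (auto simp: F_def)
  then have F_Rn: "F x k = 0" if "x \<in> ?B" "k \<ge> n" for x k
    using that by (auto simp: multiball_def topspace_Euclidean_space)
  have poly: "polynomial_map n (\<lambda>x. F x k)" if "k < n" for k
    unfolding F_def by (rule polynomial_map_funpow_fold_map[OF that])
  have H_cluster: "cluster_sq n b i (H t x) = (1 - t)\<^sup>2 * cluster_sq n b i (F x)" for i t x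
    by (rule cluster_sq_scaled) (simp add: H_def)
  have H_Rn: "H t x \<in> Rn n" if "x \<in> ?B" for t x
    using F_Rn[OF that] by (auto simp: H_def topspace_Euclidean_space)
  have H_T: "H t x \<in> ?T" if "x \<in> ?B" "t \<in> {0..1}" for t x
  proof -
    have "(1 - t)\<^sup>2 * cluster_sq n b (b k) (F x) \<le> 1 * 1" if "k < n" for k
      using F[OF \<open>x \<in> ?B\<close>] \<open>t \<in> {0..1}\<close> that
      by (intro mult_mono) (auto simp: multiball_def power_le_one cluster_sq_nonneg)
    then show ?thesis
      using H_Rn[OF that(1)] by (simp add: multiball_def H_cluster)
  qed
  let ?X = "prod_topology (top_of_set {0..1::real}) (subtopology (Euclidean_space n) ?B)"
  have "continuous_map ?X (subtopology (Euclidean_space n) ?T) (\<lambda>(t, x). H t x)"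
  proof -
    have B: "?B \<subseteq> Rn n"
      by (auto simp: closed_unit_ball_def)
    have "continuous_map ?X euclideanreal (\<lambda>p. H (fst p) (snd p) k)" for k
    proof (cases "k < n")
      case True
      have "continuous_map ?X euclideanreal (\<lambda>p. F (snd p) k)"
        using continuous_map_compose[OF continuous_map_snd
            continuous_map_from_subtopology[OF continuous_map_polynomial_map[OF poly[OF True]]]]
        by (simp add: comp_def)
      moreover have "continuous_map ?X euclideanreal fst"
        using continuous_map_fst[of "top_of_set {0..1::real}"] continuous_map_in_subtopology by blast
      ultimately show ?thesis
        unfolding H_def
        by (intro continuous_map_real_mult continuous_map_diff continuous_map_canonical_const)
    next
      case False
      show ?thesis
      proof (rule continuous_map_eq)
        show "continuous_map ?X euclideanreal (\<lambda>_. 0)"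
          by simp
        show "0 = H (fst p) (snd p) k" if "p \<in> topspace ?X" for p
          using that False F_Rn by (auto simp: H_def)
      qed
    qed
    then have "continuous_map ?X (powertop_real UNIV) (\<lambda>(t, x). H t x)"
      by (simp add: continuous_map_componentwise_UNIV case_prod_unfold)
    moreover have "(\<lambda>(t, x). H t x) \<in> topspace ?X \<rightarrow> Rn n \<inter> ?T"
      using H_Rn H_T by auto
    ultimately show ?thesis
      by (auto simp: Euclidean_space_def topspace_Euclidean_space continuous_map_in_subtopology
          Pi_iff image_subset_iff)
  qed
  moreover have "C0_polynomial_on n ?B (\<lambda>t x. H t x i)" if i: "i < n" for i
  proof -
    obtain A c where "finite A" and Fi: "\<And>x. F x i = poly_value n A c x"
      using poly[OF i] by (auto simp: polynomial_map_def)
    moreover have "H t x i = poly_value n A (\<lambda>\<alpha>. (1 - t) * c \<alpha>) x" for t x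
      by (simp add: H_def Fi poly_value_def sum_distrib_left mult.assoc)
    ultimately show ?thesis
      unfolding C0_polynomial_on_def
      by (intro exI[of _ A] exI[of _ "\<lambda>\<alpha> t. (1 - t) * c \<alpha>"]) (auto intro!: continuous_intros)
  qed
  moreover have "H 0 ` ?B = ?T"
    using funpow_fold_map_image_closed_unit_ball[of n b] by (simp add: H_def[abs_def] F_def)
  moreover have "\<exists>p. \<forall>x\<in>?B. H 1 x = p"
    by (simp add: H_def)
  moreover have "H t ` ?B \<subseteq> Euclidean_space n interior_of ?T" if "t \<in> {0<..<1}" for t
  proof -
    have "cluster_sq n b (b k) (H t x) < 1" if "x \<in> ?B" "k < n" for x k
    proof -
      have "(1 - t)\<^sup>2 * cluster_sq n b (b k) (F x) \<le> (1 - t)\<^sup>2 * 1"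
        using F[OF that(1)] that(2) by (intro mult_left_mono) (auto simp: multiball_def)
      also have "\<dots> < 1"
        using \<open>t \<in> {0<..<1}\<close> by (simp add: power_less_one_iff abs_square_less_1)
      finally show ?thesis
        by (simp add: H_cluster)
    qed
    then have "H t ` ?B \<subseteq> {x \<in> Rn n. \<forall>k<n. cluster_sq n b (b k) x < 1}"
      using H_Rn by auto
    then show ?thesis
      using open_multiball_subset_interior by (rule order_trans)
  qed
  moreover have "?T \<subseteq> Rn n"
    by (auto simp: multiball_def)
  ultimately show ?thesis
    unfolding brick_def using multiball_dim semialgebraic_multiball
    by (intro conjI exI[of _ H]) auto
qed

lemma block_labelling_exists:
  fixes l :: nat and d :: "nat \<Rightarrow> nat"
  shows "\<exists>b. (\<forall>k < (\<Sum>i<l. d i). b k < l) \<and>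
    (\<forall>i<l. {j. j < (\<Sum>i<l. d i) \<and> b j = i} = {(\<Sum>j<i. d j)..<(\<Sum>j<i. d j) + d i})"
proof (induction l)
  case 0
  show ?case by simp
next
  case (Suc l)
  define s where "s i = (\<Sum>j<i. d j)" for i
  obtain b where b: "\<And>k. k < s l \<Longrightarrow> b k < l"
    "\<And>i. i < l \<Longrightarrow> {j. j < s l \<and> b j = i} = {s i..<s i + d i}"
    using Suc by (auto simp: s_def)
  define b' where "b' k = (if k < s l then b k else l)" for k
  have "b' k < Suc l" for k
    using b(1)[of k] by (auto simp: b'_def)
  moreover have "{j. j < s l + d l \<and> b' j = i} = {s i..<s i + d i}" if "i < Suc l" for i
  proof (cases "i = l")
    case True
    have "b' j = l \<longleftrightarrow> s l \<le> j" for j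
      using b(1)[of j] by (auto simp: b'_def)
    then show ?thesis
      unfolding True by (simp add: set_eq_iff conj_commute)
  next
    case False
    then have "{j. j < s l + d l \<and> b' j = i} = {j. j < s l \<and> b j = i}"
      by (auto simp: b'_def)
    then show ?thesis
      using False that b(2) by simp
  qed
  ultimately show ?case
    by (intro exI[of _ b']) (simp add: s_def)
qed

lemma block_in_closed_unit_ball_iff:
  assumes "{j. j < n \<and> b j = i} = {(\<Sum>j<i. d j)..<(\<Sum>j<i. d j) + d i}"
  shows "block d i x \<in> closed_unit_ball (d i) \<longleftrightarrow> cluster_sq n b i x \<le> 1"
proof -
  let ?s = "\<Sum>j<i. d j"
  have "(\<Sum>k<d i. (block d i x k)\<^sup>2) = (\<Sum>k<d i. (x (?s + k))\<^sup>2)"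
    by (intro sum.cong) (auto simp: block_def)
  also have "\<dots> = cluster_sq n b i x"
    unfolding cluster_sq_def assms
    by (rule sum.reindex_bij_witness[of _ "\<lambda>j. j - ?s" "\<lambda>k. ?s + k"]) auto
  finally show ?thesis
    by (auto simp: closed_unit_ball_iff topspace_Euclidean_space block_def)
qed

lemma block_product_balls_eq_multiball:
  fixes l :: nat and d :: "nat \<Rightarrow> nat"
  defines "n \<equiv> \<Sum>i<l. d i"
  shows "\<exists>b. block_product l d (\<lambda>i. closed_unit_ball (d i)) = multiball n b 1"
proof -
  obtain b where b: "\<And>k. k < n \<Longrightarrow> b k < l"
    "\<And>i. i < l \<Longrightarrow> {j. j < n \<and> b j = i} = {(\<Sum>j<i. d j)..<(\<Sum>j<i. d j) + d i}"
    using block_labelling_exists[of d l] unfolding n_def by blast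
  have "(\<forall>i<l. cluster_sq n b i x \<le> 1) \<longleftrightarrow> (\<forall>k<n. cluster_sq n b (b k) x \<le> 1)" for x
  proof (intro iffI allI impI)
    fix i assume "\<forall>k<n. cluster_sq n b (b k) x \<le> 1" "i < l"
    moreover have "cluster_sq n b i x = 0" if "\<nexists>k. k < n \<and> b k = i"
      using that unfolding cluster_sq_def by (intro sum.neutral) auto
    ultimately show "cluster_sq n b i x \<le> 1"
      by force
  qed (use b(1) in auto)
  then have "block_product l d (\<lambda>i. closed_unit_ball (d i)) = multiball n b 1"
    unfolding block_product_def multiball_def n_def[symmetric]
    using block_in_closed_unit_ball_iff[OF b(2)] by auto
  then show ?thesis
    by blast
qed

theorem corollary2p11:
  fixes l n :: nat and d :: "nat \<Rightarrow> nat" and S :: "(nat \<Rightarrow> real) set"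
  assumes "0 < l"
    and "\<forall>i<l. 0 < d i"
    and "n = (\<Sum>i<l. d i)"
    and "S = block_product l d (\<lambda>i. closed_unit_ball (d i))"
  shows "semialgebraic_dim n S = ereal (real n) \<and> brick n n S"
proof -
  obtain b where "S = multiball n b 1"
    using block_product_balls_eq_multiball[where l = l and d = d] assms(3,4) by auto
  then show ?thesis
    using multiball_dim multiball_brick by simp
qed

end
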